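(* Let $M_0(x)=G\left(x,x^{2/5}\right)$ and $M_{n+1}(x)=G\left(x,M_n(x)\right)$ for all integers $n\ge 0$ and all real $x\ge 0$, where $G(x,y)=\sqrt[3]{2x+\frac1{27}+\frac13\sqrt{\frac{2x}{1+y}}}-\frac13$. Then: 1. For all real $x\ge 0$: $|M_0(x)-MY(x)|<C_0$, where $C_0=1.4408\cdot 10^{-3}$. 2. For all real $x>0$: $\left|\frac{M_0(x)}{MY(x)}-1\right|<C_0'$, where $C_0'=1.1527\cdot 10^{-2}$. 3. For all real $x\ge 0$ and all integers $n\ge 0$: $|M_n(x)-MY(x)|<\frac{C_0}{K^n}$, where $K=25.05$. 4. The sequence $(M_n)_{n\ge 0}$ converges uniformly to $MY$ on $[0,+\infty)$.
   Context: The function $MY:[0,+\infty)\to[0,+\infty)$ is the inverse of the strictly increasing continuous bijection $[0,+\infty)\to[0,+\infty)$, $z\mapsto \frac{z^3+z^2}{2}$; that is, for $x\ge 0$, $MY(x)$ is the unique real $z\ge 0$ with $\frac{z^3+z^2}{2}=x$. The function $G(x,y)$ is considered for $x\ge 0$, $y\ge 0$; $\sqrt[3]{\cdot}$ denotes the real cube root. *)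

theory Defs
  imports "HOL-Analysis.Analysis"
begin

definition MY :: "real \<Rightarrow> real" where
  "MY = the_inv_into {0..} (\<lambda>z. (z ^ 3 + z ^ 2) / 2)"

definition G :: "real \<Rightarrow> real \<Rightarrow> real" where
  "G x y = root 3 (2 * x + 1 / 27 + 1 / 3 * sqrt (2 * x / (1 + y))) - 1 / 3"

primrec M :: "nat \<Rightarrow> real \<Rightarrow> real" where
  "M 0 x = G x (x powr (2 / 5))"
| "M (Suc n) x = G x (M n x)"

end

theory Submission
  imports Defs
begin

text \<open>
  Write z = MY x and u = z + 1/3. Since 2x = z^2 (1 + z), one has
  (G(x,y) + 1/3)^3 = u^3 + (q - z)/3 with q = z sqrt((1 + z)/(1 + y)), so z is a fixed
  point of G(x,_), and (z - q)(z + q)(1 + y) = z^2 (y - z) turns an error of y into an error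
  of G(x,y) that is smaller by a factor of about 30 at worst.
  The initial value y = x^(2/5) satisfies y^5 = z^4 ((1 + z)/2)^2, hence by the weighted
  AM-GM inequality z \<le> y and, for every a > 0, y is at most a quadratic polynomial in z.
  With a = 1 for z in [1/8, 4] and a = 5/4 (the contact points are near z = 1/10 and z = 10)
  elsewhere, the error bounds become polynomial inequalities in z on compact
  intervals; beyond z = 80 it is enough that q \<ge> 0. For z \<le> 1/8 the relative error is the binding one, for z \<ge> 1/8 the absolute one.
\<close>

section \<open>The cubic equation behind \<open>MY\<close>\<close>

text \<open>Monotonicity gives uniqueness and the intermediate value theorem on
  \<open>[0, 1 + x]\<close> gives existence, so that everything later can be stated through
  \<open>z\<close> alone.\<close>

lemma MY_cubic:
  assumes "x \<ge> 0"
  obtains z where "z \<ge> 0" "MY x = z" "x = (z ^ 3 + z ^ 2) / 2"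
proof -
  let ?f = "\<lambda>z::real. (z ^ 3 + z ^ 2) / 2"
  have inj: "inj_on ?f {0..}"
  proof (rule strict_mono_on_imp_inj_on, rule strict_mono_onI)
    fix a b :: real
    assume "a \<in> {0..}" "b \<in> {0..}" "a < b"
    then show "?f a < ?f b"
      by (simp add: add_strict_mono power_strict_mono)
  qed
  have "\<exists>z\<ge>0. z \<le> 1 + x \<and> ?f z = x"
  proof (rule IVT')
    have "(1 + x) ^ 2 \<le> (1 + x) ^ 3"
      using assms by (intro power_increasing) auto
    moreover have "x \<le> (1 + x) ^ 2"
      using assms by (simp add: power2_eq_square algebra_simps)
    ultimately show "x \<le> ?f (1 + x)"
      by simp
  qed (use assms in \<open>auto intro!: continuous_intros\<close>)
  then obtain z where "z \<ge> 0" "?f z = x"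
    by blast
  then have "MY x = z"
    using the_inv_into_f_f[OF inj, of z] by (simp add: MY_def)
  with \<open>z \<ge> 0\<close> \<open>?f z = x\<close> show ?thesis
    by (intro that[of z]) auto
qed

section \<open>One application of \<open>G\<close>\<close>

text \<open>Naming the square root \<open>q\<close> and the cube root \<open>v\<close> and recording
  only their polynomial equations removes all roots from the later estimates.\<close>

lemma G_decomp:
  fixes x y z :: real
  assumes "z \<ge> 0" "y \<ge> 0" "x = (z ^ 3 + z ^ 2) / 2"
  obtains q v where "q \<ge> 0" "q ^ 2 * (1 + y) = z ^ 2 * (1 + z)"
    "v > 0" "v ^ 3 = (z + 1 / 3) ^ 3 + (q - z) / 3" "G x y = v - 1 / 3"
proof
  let ?q = "sqrt (2 * x / (1 + y))"
  let ?A = "2 * x + 1 / 27 + 1 / 3 * ?q"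
  have x: "x \<ge> 0" unfolding assms(3) using assms(1) by simp
  then have q0: "2 * x / (1 + y) \<ge> 0" using assms(2) by simp
  then show "?q \<ge> 0" by simp
  have "?q ^ 2 * (1 + y) = 2 * x" using q0 assms(2) by simp
  also have "\<dots> = z ^ 2 * (1 + z)"
    unfolding assms(3) by (simp add: power2_eq_square power3_eq_cube algebra_simps)
  finally show "?q ^ 2 * (1 + y) = z ^ 2 * (1 + z)" .
  have A: "?A > 0" using x q0 by (intro add_nonneg_pos add_pos_nonneg) auto
  then show "root 3 ?A > 0" by simp
  have "root 3 ?A ^ 3 = ?A" using A by simp
  also have "\<dots> = (z + 1 / 3) ^ 3 + (?q - z) / 3"
    unfolding assms(3) by (simp add: power2_eq_square power3_eq_cube algebra_simps add_divide_distrib diff_divide_distrib)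
  finally show "root 3 ?A ^ 3 = (z + 1 / 3) ^ 3 + (?q - z) / 3" .
  show "G x y = root 3 ?A - 1 / 3" by (simp add: G_def)
qed

text \<open>Factoring a difference of cubes and a difference of squares expresses
  \<open>u - v\<close> as \<open>z ^ 2 * (y - z)\<close> over a product, which closeness of
  \<open>y\<close> to \<open>z\<close> bounds from below. The radius \<open>15 / 10000\<close> is
  slightly above \<open>C\<^sub>0\<close>, so it covers every iterate.\<close>

lemma G_contraction:
  assumes z: "z \<ge> 0" and y: "y \<ge> 0" and x: "x = (z ^ 3 + z ^ 2) / 2"
    and close: "\<bar>y - z\<bar> \<le> 15 / 10000"
  shows "25.05 * \<bar>G x y - z\<bar> \<le> \<bar>y - z\<bar>"
proof -
  define T :: real where "T = 15 / 10000"
  define u where "u = z + 1 / 3"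
  obtain q v where q: "q \<ge> 0" "q ^ 2 * (1 + y) = z ^ 2 * (1 + z)"
    and v: "v > 0" "v ^ 3 = u ^ 3 + (q - z) / 3" "G x y = v - 1 / 3"
    using G_decomp[OF z y x] unfolding u_def by metis
  have yT: "z - T \<le> y" "y \<le> z + T" using close unfolding T_def by linarith+
  \<comment> \<open>A crude bound whose purpose is \<open>v_lower\<close>; the sharper control of
    \<open>q\<close> comes from \<open>sum_lower\<close>.\<close>
  have q_lower: "z * (1 - T) \<le> q"
  proof (rule power2_le_imp_le[OF _ q(1)])
    have "(1 - T) * ((1 - T) * (1 + y)) \<le> 1 * (1 + z)"
    proof (rule mult_mono)
      have "(1 - T) * (1 + y) \<le> (1 - T) * (1 + z + T)"
        using yT by (intro mult_left_mono) (auto simp: T_def)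
      also have "\<dots> \<le> 1 + z" using z by (simp add: T_def algebra_simps)
      finally show "(1 - T) * (1 + y) \<le> 1 + z" .
    qed (use y in \<open>auto simp: T_def\<close>)
    then have "z ^ 2 * ((1 - T) * ((1 - T) * (1 + y))) \<le> z ^ 2 * (1 + z)"
      by (intro mult_left_mono) auto
    then have "(z * (1 - T)) ^ 2 * (1 + y) \<le> q ^ 2 * (1 + y)"
      unfolding q(2) by (simp add: power2_eq_square mult_ac)
    then show "(z * (1 - T)) ^ 2 \<le> q ^ 2" using y by simp
  qed
  have v_lower: "u - T \<le> v"
  proof (rule power_le_imp_le_base[of _ 2])
    have "(u - T) ^ 3 \<le> u ^ 3 - z * T / 3"
      using z by (simp add: u_def T_def power3_eq_cube field_simps)
    also have "\<dots> \<le> u ^ 3 + (q - z) / 3"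
      using q_lower by (simp add: field_simps)
    finally show "(u - T) ^ Suc 2 \<le> v ^ Suc 2"
      using v(2) by (simp add: numeral_3_eq_3 numeral_2_eq_2)
  qed (use v in simp)
  have uT: "u - T \<ge> 0" using z by (simp add: u_def T_def)
  have gap: "3 * (u - T) ^ 2 \<le> u ^ 2 + u * v + v ^ 2"
  proof -
    have "(u - T) * (u - T) \<le> u * u" "(u - T) * (u - T) \<le> u * v"
      "(u - T) * (u - T) \<le> v * v"
      using uT v_lower by (intro mult_mono; simp add: T_def)+
    then show ?thesis by (simp add: power2_eq_square)
  qed
  \<comment> \<open>Squaring turns the right side into \<open>z ^ 2 * (1 + z) * (1 + y)\<close>,
    where both linear factors are at least \<open>1 + z - T\<close>.\<close>
  have "z * (1 + z - T) \<le> q * (1 + y)"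
  proof (rule power2_le_imp_le)
    have "(1 + z - T) * (1 + z - T) \<le> (1 + z) * (1 + y)"
      using yT z y by (intro mult_mono) (auto simp: T_def)
    then have "z ^ 2 * ((1 + z - T) * (1 + z - T)) \<le> z ^ 2 * ((1 + z) * (1 + y))"
      by (intro mult_left_mono) auto
    also have "\<dots> = q ^ 2 * (1 + y) * (1 + y)" unfolding q(2) by simp
    finally show "(z * (1 + z - T)) ^ 2 \<le> (q * (1 + y)) ^ 2"
      by (simp add: power2_eq_square mult_ac)
  qed (use q y in simp)
  moreover have "z * (1 + z - T) \<le> z * (1 + y)"
    using yT z by (intro mult_left_mono) auto
  ultimately have sum_lower: "2 * (z * (1 + z - T)) \<le> (z + q) * (1 + y)"
    by (simp add: algebra_simps)
  have diff: "(u - v) * (3 * (u ^ 2 + u * v + v ^ 2)) = z - q"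
  proof -
    have "(u - v) * (3 * (u ^ 2 + u * v + v ^ 2)) = 3 * (u ^ 3 - v ^ 3)"
      by (simp add: power2_eq_square power3_eq_cube algebra_simps)
    then show ?thesis unfolding v(2) by (simp add: diff_divide_distrib)
  qed
  have "(z - q) * ((z + q) * (1 + y)) = z ^ 2 * (1 + y) - q ^ 2 * (1 + y)"
    by (simp add: power2_eq_square algebra_simps)
  also have "\<dots> = z ^ 2 * (y - z)"
    unfolding q(2) by (simp add: power2_eq_square algebra_simps)
  finally have key: "(u - v) * (3 * (u ^ 2 + u * v + v ^ 2) * ((z + q) * (1 + y))) = z ^ 2 * (y - z)"
    using diff by (metis mult.assoc)
  have cubic: "25.05 * z \<le> 18 * (u - T) ^ 2 * (1 + z - T)"
  proof -
    \<comment> \<open>\<open>1.119\<close> makes the coefficients of \<open>z^2\<close> agree, leaving a linear remainder with nonnegative coefficients.\<close>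
    have "0 \<le> 18 * (z - 1 / 5) ^ 2 * (z + 2) + 1.119 * z ^ 2"
      using z by simp
    then show ?thesis
      using z by (simp add: u_def T_def power2_eq_square field_simps)
  qed
  show ?thesis
  proof (cases "z = 0")
    \<comment> \<open>Here \<open>z ^ 2\<close> cannot be cancelled from \<open>key\<close>, but
      \<open>q = 0\<close> makes \<open>G x y\<close> exactly \<open>z\<close>.\<close>
    case True
    then have "q = 0" using q y by simp
    then have "u - v = 0"
      using diff True gap uT by (auto simp: u_def T_def power2_eq_square)
    then show ?thesis using True v(3) by (simp add: u_def)
  next
    case False
    have "25.05 * z * z \<le> 18 * (u - T) ^ 2 * (1 + z - T) * z"
      using cubic z by (intro mult_right_mono) auto
    also have "\<dots> = 3 * (3 * (u - T) ^ 2) * (2 * (z * (1 + z - T)))"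
      by (simp add: algebra_simps)
    also have "\<dots> \<le> 3 * (u ^ 2 + u * v + v ^ 2) * ((z + q) * (1 + y))"
    proof (rule mult_mono)
      show "3 * (3 * (u - T) ^ 2) \<le> 3 * (u ^ 2 + u * v + v ^ 2)" using gap by simp
      show "0 \<le> 3 * (u ^ 2 + u * v + v ^ 2)" using z v(1) by (simp add: u_def)
      show "0 \<le> 2 * (z * (1 + z - T))" using z by (simp add: T_def)
    qed (rule sum_lower)
    finally have "\<bar>u - v\<bar> * (25.05 * z * z)
        \<le> \<bar>u - v\<bar> * (3 * (u ^ 2 + u * v + v ^ 2) * ((z + q) * (1 + y)))" (is "_ \<le> _ * ?D")
      by (intro mult_left_mono) auto
    also have "\<dots> = \<bar>(u - v) * ?D\<bar>"
      using z q y v by (simp add: abs_mult u_def)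
    also have "\<dots> = z ^ 2 * \<bar>y - z\<bar>"
      unfolding key by (simp add: abs_mult)
    finally have "z ^ 2 * (25.05 * \<bar>u - v\<bar>) \<le> z ^ 2 * \<bar>y - z\<bar>"
      by (simp add: power2_eq_square algebra_simps)
    then have "25.05 * \<bar>u - v\<bar> \<le> \<bar>y - z\<bar>"
      using False by simp
    moreover have "\<bar>u - v\<bar> = \<bar>G x y - z\<bar>"
      unfolding v(3) u_def by linarith
    ultimately show ?thesis by simp
  qed
qed

section \<open>Bounds for the starting value\<close>

text \<open>After division by \<open>p ^ 5\<close> this is Bernoulli's inequality with
  \<open>1 + 5 * t = q / p\<close>.\<close>

lemma weighted_am_gm_4_1:
  fixes p q :: real
  assumes "p \<ge> 0" "q \<ge> 0"
  shows "p ^ 4 * q \<le> ((4 * p + q) / 5) ^ 5"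
proof (cases "p = 0")
  case False
  let ?t = "(q / p - 1) / 5"
  have "1 + real 5 * ?t \<le> (1 + ?t) ^ 5"
    using assms False by (intro Bernoulli_inequality) (simp add: field_simps)
  then have "q / p \<le> (1 + ?t) ^ 5"
    by (simp add: diff_divide_distrib)
  then have "p ^ 5 * (q / p) \<le> p ^ 5 * (1 + ?t) ^ 5"
    using assms by (intro mult_left_mono) auto
  also have "\<dots> = (p * (1 + ?t)) ^ 5" by (simp add: power_mult_distrib)
  also have "p * (1 + ?t) = (4 * p + q) / 5" using False by (simp add: field_simps)
  also have "p ^ 5 * (q / p) = p ^ 4 * q" using False by (simp add: eval_nat_numeral)
  finally show ?thesis .
qed (use assms in simp)

text \<open>The lower bound reduces to \<open>(1 - z) ^ 2 \<ge> 0\<close>. For the upper one,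
  \<open>a ^ 4\<close> is shifted between the two factors of the fifth power before AM-GM; equality
  holds where \<open>4 * a ^ 5 * z = (1 + z) ^ 2\<close>, so \<open>a\<close> selects where the
  bound is sharp.\<close>

lemma start_value_bounds:
  fixes x z :: real
  assumes z: "z \<ge> 0" and x: "x = (z ^ 3 + z ^ 2) / 2"
  shows "z \<le> x powr (2 / 5)"
    and "a > 0 \<Longrightarrow> x powr (2 / 5) \<le> (4 * (a * z) + ((1 + z) ^ 2 / 4) / a ^ 4) / 5"
proof -
  have x0: "x \<ge> 0" unfolding x using z by simp
  have "(x powr (2 / 5)) ^ 5 = x ^ 2"
  proof (cases "x = 0")
    case False
    with x0 have "(x powr (2 / 5)) ^ 5 = x powr 2"
      using powr_realpow[of "x powr (2 / 5)" 5] by (simp add: powr_powr)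
    with x0 False show ?thesis by (simp add: powr_numeral)
  qed simp
  also have "\<dots> = z ^ 4 * ((1 + z) ^ 2 / 4)"
    unfolding x by (simp add: power2_eq_square eval_nat_numeral field_simps)
  finally have y5: "(x powr (2 / 5)) ^ 5 = z ^ 4 * ((1 + z) ^ 2 / 4)" .
  have "z \<le> (1 + z) ^ 2 / 4"
    using zero_le_power2[of "1 - z"] by (simp add: power2_eq_square algebra_simps)
  then have "z ^ 4 * z \<le> z ^ 4 * ((1 + z) ^ 2 / 4)"
    by (intro mult_left_mono) auto
  moreover have "z ^ 4 * z = z ^ 5" by (simp add: eval_nat_numeral)
  ultimately have "z ^ 5 \<le> (x powr (2 / 5)) ^ 5" unfolding y5 by simp
  then have "z ^ Suc 4 \<le> (x powr (2 / 5)) ^ Suc 4" by simp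
  then show "z \<le> x powr (2 / 5)" by (rule power_le_imp_le_base) simp
  assume a: "a > 0"
  have "(x powr (2 / 5)) ^ 5 = (a * z) ^ 4 * (((1 + z) ^ 2 / 4) / a ^ 4)"
    using a y5 by (simp add: power_mult_distrib)
  also have "\<dots> \<le> ((4 * (a * z) + ((1 + z) ^ 2 / 4) / a ^ 4) / 5) ^ 5"
    using a z by (intro weighted_am_gm_4_1) auto
  finally have "(x powr (2 / 5)) ^ Suc 4 \<le> ((4 * (a * z) + ((1 + z) ^ 2 / 4) / a ^ 4) / 5) ^ Suc 4"
    by simp
  then show "x powr (2 / 5) \<le> (4 * (a * z) + ((1 + z) ^ 2 / 4) / a ^ 4) / 5"
    by (rule power_le_imp_le_base) (use a z in simp)
qed

section \<open>Error of the first iterate\<close>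

text \<open>As \<open>y \<ge> z\<close> forces \<open>q \<le> z\<close>, the error is one-sided.
  Since \<open>(3 * z + 1) ^ 2 = 9 * u ^ 2\<close>, \<open>e\<close> bounds the error to first
  order, and \<open>T\<close> exceeds it by enough to absorb the quadratic term. Where the lower
  bound for \<open>q\<close> is negative, \<open>q \<ge> 0\<close> suffices, hence the conditional
  hypothesis.\<close>

lemma G_error_below:
  assumes z: "z \<ge> 0" and x: "x = (z ^ 3 + z ^ 2) / 2" and y: "z \<le> y"
    and e: "z - (3 * z + 1) ^ 2 * e \<ge> 0 \<Longrightarrow>
      (z - (3 * z + 1) ^ 2 * e) ^ 2 * (1 + y) \<le> z ^ 2 * (1 + z)"
    and T: "T > 0" "T ^ 2 \<le> (z + 1 / 3) * (T - e)"
  shows "\<bar>G x y - z\<bar> < T"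
proof -
  define u where "u = z + 1 / 3"
  have y0: "y \<ge> 0" using z y by simp
  obtain q v where q: "q \<ge> 0" "q ^ 2 * (1 + y) = z ^ 2 * (1 + z)"
    and v: "v > 0" "v ^ 3 = u ^ 3 + (q - z) / 3" "G x y = v - 1 / 3"
    using G_decomp[OF z y0 x] unfolding u_def by metis
  have u0: "u > 0" using z by (simp add: u_def)
  have "q \<le> z"
  proof (rule power2_le_imp_le[OF _ z])
    have "q ^ 2 * (1 + y) \<le> z ^ 2 * (1 + y)"
      unfolding q(2) using y by (intro mult_left_mono) auto
    then show "q ^ 2 \<le> z ^ 2" using y0 by simp
  qed
  then have "v ^ Suc 2 \<le> u ^ Suc 2" using v(2) by simp
  then have "v \<le> u" by (rule power_le_imp_le_base) (use u0 in simp)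
  have q_lower: "z - (3 * z + 1) ^ 2 * e \<le> q"
  proof (cases "z - (3 * z + 1) ^ 2 * e \<ge> 0")
    case True
    from e[OF this] have "(z - (3 * z + 1) ^ 2 * e) ^ 2 * (1 + y) \<le> q ^ 2 * (1 + y)"
      using q(2) by simp
    then have "(z - (3 * z + 1) ^ 2 * e) ^ 2 \<le> q ^ 2"
      using y0 by simp
    then show ?thesis using q(1) by (rule power2_le_imp_le)
  qed (use q in simp)
  \<comment> \<open>The expansion is regrouped so that \<open>T(2)\<close> makes the bracket
    nonnegative.\<close>
  have "(u - T) ^ 3 = u ^ 3 - 3 * u ^ 2 * e - 3 * u * (u * (T - e) - T ^ 2) - T ^ 3"
    by (simp add: power2_eq_square power3_eq_cube algebra_simps)
  also have "\<dots> < u ^ 3 - 3 * u ^ 2 * e"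
  proof -
    have "0 \<le> 3 * u * (u * (T - e) - T ^ 2)" using T(2) u0 by (simp add: u_def)
    moreover have "T ^ 3 > 0" using T(1) by simp
    ultimately show ?thesis by linarith
  qed
  also have "\<dots> \<le> v ^ 3"
  proof -
    have "3 * u ^ 2 * e = (3 * z + 1) ^ 2 * e / 3"
      by (simp add: u_def power2_eq_square field_simps)
    moreover have "u ^ 3 - w / 3 \<le> u ^ 3 + (q - z) / 3" if "z - w \<le> q" for w
      using that by (simp add: field_simps)
    ultimately show ?thesis using q_lower v(2) by metis
  qed
  finally have "u - T < v"
    by (rule power_less_imp_less_base) (use v in simp)
  with \<open>v \<le> u\<close> show ?thesis using v(3) by (simp add: u_def)
qed

text \<open>The polynomial inequalities below are proved by expanding the difference of the two sides
  in the Bernstein basis of the interval, where all coefficients are positive.\<close>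

lemma start_polynomial_small:
  fixes z :: real
  assumes "0 \<le> z" "z \<le> 1 / 8"
  shows "(1 - (3 * z + 1) ^ 2 / 88) ^ 2 * (1 + (4 * (5 / 4 * z) + ((1 + z) ^ 2 / 4) / (5 / 4) ^ 4) / 5) \<le> 1 + z"
proof -
  have "24200000 * (1 + z - (1 - (3 * z + 1) ^ 2 / 88) ^ 2 * (1 + (4 * (5 / 4 * z) + ((1 + z) ^ 2 / 4) / (5 / 4) ^ 4) / 5)) =
      62459 * (1 - 8 * z) ^ 6
      + 5905391 * z * (1 - 8 * z) ^ 5
      + 184045886 * z ^ 2 * (1 - 8 * z) ^ 4
      + 2754297766 * z ^ 3 * (1 - 8 * z) ^ 3
      + 21827135407 * z ^ 4 * (1 - 8 * z) ^ 2
      + 88672230955 * z ^ 5 * (1 - 8 * z)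
      + 145924283736 * z ^ 6"
    by (simp add: power2_eq_square power3_eq_cube eval_nat_numeral field_simps)
  also have "\<dots> \<ge> 0"
    using assms by (intro add_nonneg_nonneg mult_nonneg_nonneg zero_le_power) auto
  finally show ?thesis by simp
qed

lemma start_polynomial_medium:
  fixes z :: real
  assumes "1 / 8 \<le> z" "z \<le> 4"
  shows "(z - (3 * z + 1) ^ 2 / 700) ^ 2 * (1 + (4 * z + (1 + z) ^ 2 / 4) / 5) \<le> z ^ 2 * (1 + z)"
proof -
  have "8697536073800000 * (z ^ 2 * (1 + z) - (z - (3 * z + 1) ^ 2 / 700) ^ 2 * (1 + (4 * z + (1 + z) ^ 2 / 4) / 5)) =
      459452351 * (4 - z) ^ 6
      + 2887600274 * (8 * z - 1) * (4 - z) ^ 5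
      + 14548968309 * (8 * z - 1) ^ 2 * (4 - z) ^ 4
      + 44569144268 * (8 * z - 1) ^ 3 * (4 - z) ^ 3
      + 11773273641 * (8 * z - 1) ^ 4 * (4 - z) ^ 2
      + 1041060770 * (8 * z - 1) ^ 5 * (4 - z)
      + 29484451 * (8 * z - 1) ^ 6"
    by (simp add: power2_eq_square power3_eq_cube eval_nat_numeral field_simps)
  also have "\<dots> \<ge> 0"
    using assms by (intro add_nonneg_nonneg mult_nonneg_nonneg zero_le_power) auto
  finally show ?thesis by simp
qed

lemma start_polynomial_large:
  fixes z :: real
  assumes "4 \<le> z" "z \<le> 80"
  shows "(z - (3 * z + 1) ^ 2 / 700) ^ 2 * (1 + (4 * (5 / 4 * z) + ((1 + z) ^ 2 / 4) / (5 / 4) ^ 4) / 5) \<le> z ^ 2 * (1 + z)"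
proof -
  have "295071765632000000000 * (z ^ 2 * (1 + z) - (z - (3 * z + 1) ^ 2 / 700) ^ 2 * (1 + (4 * (5 / 4 * z) + ((1 + z) ^ 2 / 4) / (5 / 4) ^ 4) / 5)) =
      3265776775 * (80 - z) ^ 6
      + 271250339710 * (z - 4) * (80 - z) ^ 5
      + 8770936500461 * (z - 4) ^ 2 * (80 - z) ^ 4
      + 136173616701908 * (z - 4) ^ 3 * (80 - z) ^ 3
      + 993375934247409 * (z - 4) ^ 4 * (80 - z) ^ 2
      + 2655547106081742 * (z - 4) ^ 5 * (80 - z)
      + 790885406860731 * (z - 4) ^ 6"
    by (simp add: power2_eq_square power3_eq_cube eval_nat_numeral field_simps)
  also have "\<dots> \<ge> 0"
    using assms by (intro add_nonneg_nonneg mult_nonneg_nonneg zero_le_power) auto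
  finally show ?thesis by simp
qed


text \<open>The first-order error \<open>z / 88\<close> is proportional to \<open>z\<close>, so
  \<open>z ^ 2\<close> cancels from the inequality to be checked. The constants satisfy
  \<open>1 / 88 < 115 / 10000 < C\<^sub>0'\<close>.\<close>

lemma start_error_small:
  assumes z: "0 < z" "z \<le> 1 / 8" and x: "x = (z ^ 3 + z ^ 2) / 2"
  shows "\<bar>M 0 x - z\<bar> < 115 / 10000 * z"
proof -
  let ?y = "x powr (2 / 5)" and ?d = "1 - (3 * z + 1) ^ 2 / 88"
  have "?d ^ 2 * (1 + ?y) \<le> ?d ^ 2 * (1 + (4 * (5 / 4 * z) + ((1 + z) ^ 2 / 4) / (5 / 4) ^ 4) / 5)"
    using start_value_bounds(2)[OF _ x, of "5 / 4"] z by (intro mult_left_mono) auto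
  also have "\<dots> \<le> 1 + z"
    using start_polynomial_small z by simp
  finally have "z ^ 2 * (?d ^ 2 * (1 + ?y)) \<le> z ^ 2 * (1 + z)"
    by (intro mult_left_mono) auto
  then have "(z * ?d) ^ 2 * (1 + ?y) \<le> z ^ 2 * (1 + z)"
    by (simp only: power_mult_distrib mult.assoc)
  moreover have "z * ?d = z - (3 * z + 1) ^ 2 * (z / 88)"
    by (simp add: algebra_simps)
  ultimately have "(z - (3 * z + 1) ^ 2 * (z / 88)) ^ 2 * (1 + ?y) \<le> z ^ 2 * (1 + z)"
    by simp
  moreover have "(115 / 10000 * z) ^ 2 \<le> (z + 1 / 3) * (115 / 10000 * z - z / 88)"
    using z by (simp add: power2_eq_square field_simps)
  ultimately show ?thesis
    using z G_error_below[OF _ x start_value_bounds(1)[OF _ x], of "z / 88" "115 / 10000 * z"] by simp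
qed

text \<open>The first-order error is now constant, with
  \<open>1 / 700 < 144 / 100000 < C\<^sub>0\<close>.\<close>

lemma start_error_large:
  assumes z: "1 / 8 \<le> z" and x: "x = (z ^ 3 + z ^ 2) / 2"
  shows "\<bar>M 0 x - z\<bar> < 144 / 100000"
proof -
  let ?y = "x powr (2 / 5)" and ?d = "z - (3 * z + 1) ^ 2 / 700"
  have z0: "z \<ge> 0" using z by simp
  have bound: "?d ^ 2 * (1 + ?y) \<le> ?d ^ 2 * (1 + (4 * (a * z) + ((1 + z) ^ 2 / 4) / a ^ 4) / 5)"
    if "a > 0" for a
    using start_value_bounds(2)[OF z0 x that] by (intro mult_left_mono) auto
  have "?d ^ 2 * (1 + ?y) \<le> z ^ 2 * (1 + z)" if "?d \<ge> 0"
  proof -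
    consider "z \<le> 4" | "4 \<le> z" "z \<le> 80" | "80 < z" by linarith
    then show ?thesis
    proof cases
      case 1
      then show ?thesis using bound[of 1] start_polynomial_medium[OF z] by simp
    next
      case 2
      then show ?thesis using bound[of "5 / 4"] start_polynomial_large by fastforce
    next
      \<comment> \<open>Since \<open>9 * 80 > 700\<close>, \<open>?d\<close> is negative here,
        contradicting \<open>?d \<ge> 0\<close>.\<close>
      case 3
      then have "80 * z \<le> z * z" by simp
      moreover have "(3 * z + 1) ^ 2 = 9 * (z * z) + 6 * z + 1" by algebra
      ultimately have "720 * z \<le> (3 * z + 1) ^ 2" using 3 by linarith
      then have "?d < 0" using 3 by simp
      with that show ?thesis by simp
    qed
  qed
  moreover have "(144 / 100000) ^ 2 \<le> (z + 1 / 3) * (144 / 100000 - 1 / 700)"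
    using z by (simp add: power2_eq_square field_simps)
  ultimately show ?thesis
    using G_error_below[OF z0 x start_value_bounds(1)[OF z0 x], of "1 / 700" "144 / 100000"] by simp
qed

section \<open>Nonnegative iterates and the four claims\<close>

lemma G_nonneg:
  assumes "x \<ge> 0" "y \<ge> 0"
  shows "G x y \<ge> 0"
proof -
  have "root 3 ((1 / 3) ^ 3) \<le> root 3 (2 * x + 1 / 27 + 1 / 3 * sqrt (2 * x / (1 + y)))"
    using assms by (intro real_root_le_mono) (auto simp: power3_eq_cube)
  then show ?thesis
    by (simp add: G_def real_root_power_cancel del: power_one_over)
qed

lemma M_nonneg: "x \<ge> 0 \<Longrightarrow> M n x \<ge> 0"
  by (induction n) (simp_all add: G_nonneg)

theorem mainTheorem1:
  fixes C\<^sub>0 C\<^sub>0' K :: real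
  defines "C\<^sub>0 \<equiv> 1.4408 / 10 ^ 3"
    and "C\<^sub>0' \<equiv> 1.1527 / 10 ^ 2"
    and "K \<equiv> 25.05"
  shows "(\<forall>x\<ge>0. \<bar>M 0 x - MY x\<bar> < C\<^sub>0)
    \<and> (\<forall>x>0. \<bar>M 0 x / MY x - 1\<bar> < C\<^sub>0')
    \<and> (\<forall>x\<ge>0. \<forall>n. \<bar>M n x - MY x\<bar> < C\<^sub>0 / K ^ n)
    \<and> uniform_limit {0..} M MY sequentially"
proof -
  have start: "\<bar>M 0 x - MY x\<bar> < C\<^sub>0 \<and> (x > 0 \<longrightarrow> \<bar>M 0 x / MY x - 1\<bar> < C\<^sub>0')" if "x \<ge> 0" for x
  proof -
    obtain z where z: "z \<ge> 0" "MY x = z" "x = (z ^ 3 + z ^ 2) / 2"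
      using MY_cubic[OF \<open>x \<ge> 0\<close>] by metis
    show ?thesis
    proof (cases "z = 0")
      \<comment> \<open>Here \<open>x = 0\<close>, so the relative claim is vacuous and
        \<open>M 0 x\<close> is \<open>root 3 (1 / 27) - 1 / 3 = 0\<close>.\<close>
      case True
      then have "M 0 x = 0"
        using z real_root_power_cancel[of 3 "1 / 3"] by (simp add: G_def power3_eq_cube)
      then show ?thesis using True z by (simp add: C\<^sub>0_def)
    next
      case False
      then have pos: "z > 0" using z by simp
      have "\<bar>M 0 x - z\<bar> < C\<^sub>0 \<and> \<bar>M 0 x - z\<bar> < C\<^sub>0' * z"
      proof (cases "z \<le> 1 / 8")
        case True
        have "\<bar>M 0 x - z\<bar> < 115 / 10000 * z"
          using start_error_small[OF pos True z(3)] .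
        \<comment> \<open>At \<open>z = 1 / 8\<close> the left side is \<open>0.0014375\<close>,
          just below \<open>C\<^sub>0\<close>, so one relative bound yields both claims.\<close>
        moreover have "115 / 10000 * z < C\<^sub>0" "115 / 10000 * z < C\<^sub>0' * z"
          using pos True by (auto simp: C\<^sub>0_def C\<^sub>0'_def)
        ultimately show ?thesis by linarith
      next
        case False
        then have "\<bar>M 0 x - z\<bar> < 144 / 100000"
          using start_error_large z(3) by simp
        \<comment> \<open>The second inequality is tight:
          \<open>C\<^sub>0' / 8 = 0.001440875\<close>.\<close>
        moreover have "144 / 100000 < C\<^sub>0" "144 / 100000 < C\<^sub>0' * z"
          using False by (auto simp: C\<^sub>0_def C\<^sub>0'_def)
        ultimately show ?thesis by linarith
      qed
      moreover have "\<bar>M 0 x / z - 1\<bar> = \<bar>M 0 x - z\<bar> / z"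
      proof -
        have "M 0 x / z - 1 = (M 0 x - z) / z"
          using pos by (simp add: diff_divide_distrib)
        then show ?thesis using pos by (simp only: abs_divide abs_of_pos)
      qed
      ultimately show ?thesis
        using pos z(2) by (simp add: pos_divide_less_eq)
    qed
  qed
  have iter: "\<bar>M n x - MY x\<bar> < C\<^sub>0 / K ^ n" if "x \<ge> 0" for n x
  proof (induction n)
    case 0
    then show ?case using start[OF that] by simp
  next
    case (Suc n)
    obtain z where z: "z \<ge> 0" "MY x = z" "x = (z ^ 3 + z ^ 2) / 2"
      using MY_cubic[OF \<open>x \<ge> 0\<close>] by metis
    \<comment> \<open>The errors never exceed \<open>C\<^sub>0\<close>, so each iterate stays within
      the radius of \<open>G_contraction\<close>.\<close>
    have "C\<^sub>0 / K ^ n \<le> C\<^sub>0 / 1"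
      by (intro divide_left_mono one_le_power) (auto simp: C\<^sub>0_def K_def)
    then have "\<bar>M n x - z\<bar> \<le> 15 / 10000"
      using Suc z(2) by (simp add: C\<^sub>0_def)
    then have "K * \<bar>M (Suc n) x - z\<bar> \<le> \<bar>M n x - z\<bar>"
      using G_contraction[OF z(1) M_nonneg[OF that] z(3)] by (simp add: K_def)
    also have "\<dots> < C\<^sub>0 / K ^ n" using Suc z(2) by simp
    finally show ?case
      unfolding z(2) by (simp add: K_def field_simps)
  qed
  have "uniform_limit {0..} M MY sequentially"
  proof (rule uniform_limitI)
    fix e :: real
    assume "e > 0"
    \<comment> \<open>The bound from \<open>iter\<close> is independent of \<open>x\<close>, which
      makes the convergence uniform.\<close>
    have "(\<lambda>n. C\<^sub>0 / K ^ n) \<longlonglongrightarrow> 0"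
      by (rule LIMSEQ_divide_realpow_zero) (simp add: K_def)
    then have "\<forall>\<^sub>F n in sequentially. C\<^sub>0 / K ^ n < e"
      using \<open>e > 0\<close> by (rule order_tendstoD)
    then show "\<forall>\<^sub>F n in sequentially. \<forall>x\<in>{0..}. dist (M n x) (MY x) < e"
    proof eventually_elim
      case (elim n)
      then show ?case using iter[of _ n] by (fastforce simp: dist_real_def)
    qed
  qed
  with start iter show ?thesis by auto
qed

end
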